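(* Let $N\ge 1$, $x_1,\dots,x_N\in\mathcal X\subset\mathbb R^d$ with $\sup_{x\in\mathcal X}\|x\|_2\le B<\infty$, $y_1,\dots,y_N\in\{-1,1\}$, let $\varphi:\mathbb R\to\mathbb R$ be convex with continuous third derivative, and for $w\in\mathbb R^d$ let $$\ell(w)=\frac1N\sum_{i=1}^N\varphi(y_i w^Tx_i)+\frac{\gamma}{2}\|w\|_2^2 .$$ Assume that $\gamma>0$ and that there exist $Q>0$ and $\alpha\in[0,1)$ such that $|\varphi'''(t)|\le Q(\varphi''(t))^{1-\alpha}$ for every $t\in\mathbb R$. Then: (a) The function $\ell$ is self-concordant with parameter $\dfrac{B^{1+2\alpha}Q}{\gamma^{1/2+\alpha}}$. (b) The scaled function $f(w)=\dfrac{B^{2+4\alpha}Q^2}{4\gamma^{1+2\alpha}}\,\ell(w)$ is standard self-concordant.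
   Context: For a function $f:\mathbb R^d\to\mathbb R$ with continuous third derivatives, $f''(w)$ is the Hessian and $f'''(w)[u]=\lim_{t\to0}\frac1t\bigl(f''(w+tu)-f''(w)\bigr)\in\mathbb R^{d\times d}$. A convex function $f$ is self-concordant with parameter $M_f$ if $|u^T(f'''(w)[u])u|\le M_f\,(u^Tf''(w)u)^{3/2}$ for all $w\in\mathrm{dom}(f)$ and all $u\in\mathbb R^d$. It is standard self-concordant if it is self-concordant with parameter $2$. *)

theory Defs
  imports "HOL-Analysis.Analysis"
begin

definition gradient :: "(real ^ 'n \<Rightarrow> real) \<Rightarrow> real ^ 'n \<Rightarrow> real ^ 'n" where
  "gradient f w = (\<chi> i. frechet_derivative f (at w) (axis i 1))"

definition hessian :: "(real ^ 'n \<Rightarrow> real) \<Rightarrow> real ^ 'n \<Rightarrow> real ^ 'n ^ 'n" where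
  "hessian f w = jacobian (gradient f) (at w)"

definition third_derivative ::
    "(real ^ 'n \<Rightarrow> real) \<Rightarrow> real ^ 'n \<Rightarrow> real ^ 'n \<Rightarrow> real ^ 'n ^ 'n" where
  "third_derivative f w u = Lim (at 0) (\<lambda>t. (1 / t) *\<^sub>R (hessian f (w + t *\<^sub>R u) - hessian f w))"

(* The derivative of the Hessian at w is the linear map sending u to third_derivative f w u; in
   finite dimension, continuity of w |-> third_derivative f w u for every direction u is the same
   as continuity of this derivative in operator norm. *)
definition C3 :: "(real ^ 'n \<Rightarrow> real) \<Rightarrow> bool" where
  "C3 f \<longleftrightarrow> f differentiable_on UNIV \<and> gradient f differentiable_on UNIV \<and>
    hessian f differentiable_on UNIV \<and> (\<forall>u. continuous_on UNIV (\<lambda>w. third_derivative f w u))"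

(* The quadratic form of the Hessian is nonnegative because f is convex, and 0 powr (3/2) = 0. *)
definition self_concordant :: "real \<Rightarrow> (real ^ 'n \<Rightarrow> real) \<Rightarrow> bool" where
  "self_concordant M f \<longleftrightarrow> convex_on UNIV f \<and> C3 f \<and>
    (\<forall>w u. \<bar>u \<bullet> (third_derivative f w u *v u)\<bar> \<le> M * (u \<bullet> (hessian f w *v u)) powr (3 / 2))"

definition standard_self_concordant :: "(real ^ 'n \<Rightarrow> real) \<Rightarrow> bool" where
  "standard_self_concordant f \<longleftrightarrow> self_concordant 2 f"

definition regularized_loss ::
    "(real \<Rightarrow> real) \<Rightarrow> real \<Rightarrow> nat \<Rightarrow> (nat \<Rightarrow> real ^ 'n) \<Rightarrow> (nat \<Rightarrow> real) \<Rightarrow> real ^ 'n \<Rightarrow> real" where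
  "regularized_loss \<phi> \<gamma> N x y w =
    (1 / real N) * (\<Sum>i = 1..N. \<phi> (y i * (w \<bullet> x i))) + \<gamma> / 2 * (norm w)\<^sup>2"

end

theory Submission
  imports Defs
begin

text \<open>
  Write \<open>h = u \<bullet> \<ell>''(w) u\<close> and \<open>a\<^sub>i = \<phi>''(s\<^sub>i) (x\<^sub>i \<bullet> u)\<^sup>2\<close>, so that \<open>h\<close> is the mean of the
  \<open>a\<^sub>i\<close> plus \<open>\<gamma> \<parallel>u\<parallel>\<^sup>2\<close>. The growth condition on \<open>\<phi>'''\<close> bounds the third derivative by \<open>Q\<close> times the
  mean of \<open>a\<^sub>i powr (1 - \<alpha>) * \<bar>x\<^sub>i \<bullet> u\<bar> powr (1 + 2 * \<alpha>)\<close>. The second factor is at most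
  \<open>(B \<parallel>u\<parallel>) powr (1 + 2 * \<alpha>) \<le> B powr (1 + 2 * \<alpha>) * (h / \<gamma>) powr (1 / 2 + \<alpha>)\<close>, and by weighted AM-GM
  the mean of \<open>a\<^sub>i powr (1 - \<alpha>)\<close> is at most \<open>h powr (1 - \<alpha>)\<close>; the exponents of \<open>h\<close> add up to \<open>3 / 2\<close>.
  Scaling \<open>\<ell>\<close> by \<open>c\<close> divides the self-concordance parameter by \<open>sqrt c\<close>.
\<close>

section \<open>Gradient, Hessian and third derivative from Frechet derivatives\<close>

lemma gradient_eqI:
  assumes "\<And>w. (f has_derivative (\<lambda>u. g w \<bullet> u)) (at w)"
  shows "gradient f = g"
  by (rule ext, simp add: gradient_def vec_eq_iff inner_axis flip: frechet_derivative_at[OF assms])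

lemma hessian_eqI:
  assumes "\<And>w. (f has_derivative (\<lambda>u. g w \<bullet> u)) (at w)"
    and "\<And>w. (g has_derivative (\<lambda>u. H w *v u)) (at w)"
  shows "hessian f = H"
  by (rule ext, simp add: hessian_def jacobian_def gradient_eqI[OF assms(1)]
      flip: frechet_derivative_at[OF assms(2)])

text \<open>Since \<open>third_derivative\<close> is a \<open>Lim\<close>, its value can only be
  read off from convergent difference quotients. Convergence is the chain rule along the line t -> w
  + t u.\<close>

lemma tendsto_directional_derivative:
  fixes F :: "'a::real_normed_vector \<Rightarrow> 'b::real_normed_vector"
  assumes "(F has_derivative F') (at w)"
  shows "((\<lambda>t. (1 / t) *\<^sub>R (F (w + t *\<^sub>R u) - F w)) \<longlongrightarrow> F' u) (at (0::real))"
proof -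
  have "((\<lambda>t. w + t *\<^sub>R u) has_derivative (\<lambda>t. t *\<^sub>R u)) (at (0::real))"
    by (auto intro!: derivative_eq_intros)
  then have "((\<lambda>t. F (w + t *\<^sub>R u)) has_derivative (\<lambda>t. F' (t *\<^sub>R u))) (at 0)"
    by (rule has_derivative_compose) (use assms in simp)
  then have "((\<lambda>t. F (w + t *\<^sub>R u)) has_vector_derivative F' u) (at 0)"
    using linear_cmul[OF has_derivative_linear[OF assms]] by (simp add: has_vector_derivative_def)
  then have lim: "((\<lambda>t. norm (F (w + t *\<^sub>R u) - F w - t *\<^sub>R F' u) / norm t) \<longlongrightarrow> 0) (at 0)"
    by (simp add: has_vector_derivative_def has_derivative_iff_norm)
  \<comment> \<open>The two sides may differ at t = 0, where 1 / t is 0, but the filter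
    \<open>at 0\<close> ignores that point.\<close>
  have eq: "norm (F (w + t *\<^sub>R u) - F w - t *\<^sub>R F' u) / norm t
      = norm ((1 / t) *\<^sub>R (F (w + t *\<^sub>R u) - F w) - F' u)" if "t \<noteq> 0" for t
  proof -
    have "(1 / t) *\<^sub>R (F (w + t *\<^sub>R u) - F w) - F' u = (1 / t) *\<^sub>R (F (w + t *\<^sub>R u) - F w - t *\<^sub>R F' u)"
      using that by (simp add: scaleR_diff_right)
    then show ?thesis by simp
  qed
  have "((\<lambda>t. norm ((1 / t) *\<^sub>R (F (w + t *\<^sub>R u) - F w) - F' u)) \<longlongrightarrow> 0) (at 0)"
    using lim by (rule Lim_transform_eventually) (auto simp: eventually_at_filter eq[simplified])
  then show ?thesis
    using Lim_null tendsto_norm_zero_iff by blast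
qed

lemma third_derivative_eqI:
  assumes "\<And>w. (f has_derivative (\<lambda>u. g w \<bullet> u)) (at w)"
    and "\<And>w. (g has_derivative (\<lambda>u. H w *v u)) (at w)"
    and "\<And>w. (H has_derivative T w) (at w)"
  shows "third_derivative f = T"
  by (intro ext)
    (simp add: third_derivative_def hessian_eqI[OF assms(1,2)]
      tendsto_Lim[OF _ tendsto_directional_derivative[OF assms(3)]])

lemma C3I:
  assumes "\<And>w. (f has_derivative (\<lambda>u. g w \<bullet> u)) (at w)"
    and "\<And>w. (g has_derivative (\<lambda>u. H w *v u)) (at w)"
    and "\<And>w. (H has_derivative T w) (at w)"
    and "\<And>u. continuous_on UNIV (\<lambda>w. T w u)"
  shows "C3 f"
  unfolding C3_def gradient_eqI[OF assms(1)] hessian_eqI[OF assms(1,2)]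
    third_derivative_eqI[OF assms(1-3)]
  using assms by (auto simp: differentiable_on_def differentiable_def)

text \<open>Lets concrete functions be handled through exhibited derivatives \<open>g\<close>,
  \<open>H\<close>, \<open>T\<close>, without unfolding \<open>frechet_derivative\<close>,
  \<open>jacobian\<close> or \<open>Lim\<close>.\<close>

lemma self_concordantI:
  assumes "convex_on UNIV f"
    and "\<And>w. (f has_derivative (\<lambda>u. g w \<bullet> u)) (at w)"
    and "\<And>w. (g has_derivative (\<lambda>u. H w *v u)) (at w)"
    and "\<And>w. (H has_derivative T w) (at w)"
    and "\<And>u. continuous_on UNIV (\<lambda>w. T w u)"
    and "\<And>w u. \<bar>u \<bullet> (T w u *v u)\<bar> \<le> M * (u \<bullet> (H w *v u)) powr (3 / 2)"
  shows "self_concordant M f"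
  unfolding self_concordant_def hessian_eqI[OF assms(2,3)] third_derivative_eqI[OF assms(2-4)]
  using assms(1,6) C3I[OF assms(2-5)] by blast

section \<open>Scaling a self-concordant function\<close>

text \<open>A converse to \<open>C3I\<close>, needed because scaling concerns an arbitrary
  \<open>f\<close> whose derivatives are known only through the definitions. For the gradient, a
  linear functional is determined by its values on the basis vectors.\<close>

lemma C3_derivatives:
  assumes "C3 f"
  shows "(f has_derivative (\<lambda>u. gradient f w \<bullet> u)) (at w)"
    and "(gradient f has_derivative (\<lambda>u. hessian f w *v u)) (at w)"
    and "(hessian f has_derivative third_derivative f w) (at w)"
proof -
  have f: "f differentiable at w" and g: "gradient f differentiable at w"
    and h: "hessian f differentiable at w"
    using assms by (auto simp: C3_def differentiable_on_def)
  have lin: "linear (frechet_derivative f (at w))"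
    using f by (rule linear_frechet_derivative)
  have "frechet_derivative f (at w) u = gradient f w \<bullet> u" for u
  proof -
    have "frechet_derivative f (at w) u = frechet_derivative f (at w) (\<Sum>i\<in>UNIV. (u $ i) *\<^sub>R axis i 1)"
      by (metis basis_expansion scalar_mult_eq_scaleR)
    also have "\<dots> = gradient f w \<bullet> u"
      by (simp add: linear_sum[OF lin] linear_cmul[OF lin] gradient_def inner_vec_def mult.commute)
    finally show ?thesis .
  qed
  then show "(f has_derivative (\<lambda>u. gradient f w \<bullet> u)) (at w)"
    using f by (metis (no_types, lifting) ext frechet_derivative_works)
  show "(gradient f has_derivative (\<lambda>u. hessian f w *v u)) (at w)"
    using g unfolding hessian_def jacobian_works .
  obtain D where D: "(hessian f has_derivative D) (at w)"
    using h by (auto simp: differentiable_def)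
  have "third_derivative f w = D"
    by (rule ext) (simp add: third_derivative_def
        tendsto_Lim[OF _ tendsto_directional_derivative[OF D]])
  with D show "(hessian f has_derivative third_derivative f w) (at w)"
    by simp
qed

text \<open>The hypothesis on \<open>M'\<close> avoids the quotient \<open>M / sqrt c\<close>, since \<open>c = 0\<close> occurs when \<open>B = 0\<close>.\<close>

lemma self_concordant_scale:
  assumes f: "self_concordant M f" and c: "0 \<le> c" and M': "c * M \<le> M' * c powr (3 / 2)"
  shows "self_concordant M' (\<lambda>w. c * f w)"
proof (rule self_concordantI)
  have "C3 f" and conv: "convex_on UNIV f"
    and bound: "\<And>w u. \<bar>u \<bullet> (third_derivative f w u *v u)\<bar> \<le> M * (u \<bullet> (hessian f w *v u)) powr (3 / 2)"
    using f by (auto simp: self_concordant_def)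
  note deriv = C3_derivatives[OF \<open>C3 f\<close>]
  show "convex_on UNIV (\<lambda>w. c * f w)"
    using c conv by (rule convex_on_cmul)
  show "((\<lambda>w. c * f w) has_derivative (\<lambda>u. (c *\<^sub>R gradient f w) \<bullet> u)) (at w)" for w
    by (auto intro!: derivative_eq_intros deriv)
  show "((\<lambda>w. c *\<^sub>R gradient f w) has_derivative (\<lambda>u. (c *\<^sub>R hessian f w) *v u)) (at w)" for w
    using has_derivative_scaleR_right[OF deriv(2)] by (simp add: scaleR_matrix_vector_assoc)
  show "((\<lambda>w. c *\<^sub>R hessian f w) has_derivative (\<lambda>u. c *\<^sub>R third_derivative f w u)) (at w)" for w
    by (rule has_derivative_scaleR_right[OF deriv(3)])
  show "continuous_on UNIV (\<lambda>w. c *\<^sub>R third_derivative f w u)" for u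
    using \<open>C3 f\<close> by (auto simp: C3_def intro!: continuous_intros)
  fix w u
  define h where "h = u \<bullet> (hessian f w *v u)"
  have "\<bar>u \<bullet> ((c *\<^sub>R third_derivative f w u) *v u)\<bar> = c * \<bar>u \<bullet> (third_derivative f w u *v u)\<bar>"
    using c by (simp add: abs_mult flip: scaleR_matrix_vector_assoc)
  also have "\<dots> \<le> c * M * h powr (3 / 2)"
    using mult_left_mono[OF bound c] by (simp add: h_def mult.assoc)
  \<comment> \<open>The third derivative scales like c, the bound like c^(3/2); the hypothesis on
    \<open>M'\<close> compares the two.\<close>
  also have "\<dots> \<le> M' * c powr (3 / 2) * h powr (3 / 2)"
    using M' by (rule mult_right_mono) simp
  \<comment> \<open>The sign of \<open>h\<close> has not been established here, so the case split
    also covers negative \<open>h\<close>.\<close>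
  also have "\<dots> = M' * (c * h) powr (3 / 2)"
    using c by (cases "h \<ge> 0") (auto simp: powr_mult)
  finally show "\<bar>u \<bullet> ((c *\<^sub>R third_derivative f w u) *v u)\<bar>
      \<le> M' * (u \<bullet> ((c *\<^sub>R hessian f w) *v u)) powr (3 / 2)"
    by (simp add: h_def flip: scaleR_matrix_vector_assoc)
qed

section \<open>Rank-one matrices and convexity\<close>

text \<open>The matrix a b^T. With y^2 = 1, the Hessian of w -> \<phi>(y (w . v)) is \<phi>'' times
  \<open>outer_prod v v\<close>.\<close>

definition outer_prod :: "real ^ 'n \<Rightarrow> real ^ 'n \<Rightarrow> real ^ 'n ^ 'n" where
  "outer_prod a b = (\<chi> i j. a $ i * b $ j)"

lemma outer_prod_mult_vec: "outer_prod a b *v u = (b \<bullet> u) *\<^sub>R a"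
  by (simp add: outer_prod_def vec_eq_iff matrix_vector_mult_def inner_vec_def sum_distrib_left
      mult_ac)

lemma sum_matrix_vector_mult:
  fixes A :: "'i \<Rightarrow> real ^ 'n ^ 'm"
  shows "(\<Sum>i\<in>I. A i) *v u = (\<Sum>i\<in>I. A i *v u)"
  by (induction I rule: infinite_finite_induct) (simp_all add: matrix_vector_mult_add_rdistrib)

text \<open>The gap in the convexity inequality is exactly t (1 - t) times the squared norm of a -
  b.\<close>

lemma convex_on_norm_square: "convex_on UNIV (\<lambda>w::'a::real_inner. (norm w)\<^sup>2)"
proof (rule convex_onI)
  fix t :: real and a b :: 'a
  assume "0 < t" "t < 1"
  then have "0 \<le> t * (1 - t) * ((a - b) \<bullet> (a - b))" by simp
  then show "(norm ((1 - t) *\<^sub>R a + t *\<^sub>R b))\<^sup>2 \<le> (1 - t) * (norm a)\<^sup>2 + t * (norm b)\<^sup>2"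
    unfolding power2_norm_eq_inner by (simp add: algebra_simps inner_commute)
qed simp

lemma convex_on_compose_inner:
  assumes "convex_on UNIV \<phi>"
  shows "convex_on UNIV (\<lambda>w. \<phi> (c * (w \<bullet> v)))"
proof (rule convex_onI)
  fix t :: real and a b
  assume "0 < t" "t < 1"
  then show "\<phi> (c * (((1 - t) *\<^sub>R a + t *\<^sub>R b) \<bullet> v)) \<le> (1 - t) * \<phi> (c * (a \<bullet> v)) + t * \<phi> (c * (b \<bullet> v))"
    using convex_onD[OF assms, of t "c * (a \<bullet> v)" "c * (b \<bullet> v)"] by (simp add: algebra_simps)
qed simp

lemma convex_on_sum_fun:
  assumes "\<And>i. i \<in> I \<Longrightarrow> convex_on S (f i)" and "convex S"
  shows "convex_on S (\<lambda>w. \<Sum>i\<in>I. f i w)"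
  using assms
  by (induction I rule: infinite_finite_induct) (auto intro!: convex_on_add simp: convex_on_const)

text \<open>Adding the tangent inequalities at two points shows that \<phi>' is monotone, so its
  derivative is nonnegative.\<close>

lemma convex_on_second_derivative_nonneg:
  assumes conv: "convex_on UNIV \<phi>"
    and d1: "\<And>t. (\<phi> has_real_derivative \<phi>' t) (at t)"
    and d2: "(\<phi>' has_real_derivative \<phi>'') (at t)"
  shows "0 \<le> \<phi>''"
proof (rule mono_on_imp_deriv_nonneg[OF _ d2])
  show "mono_on UNIV \<phi>'"
  proof (rule mono_onI)
    fix r s :: real
    assume "r \<le> s"
    have tangent: "\<phi>' b * (a - b) \<le> \<phi> a - \<phi> b" for a b
      by (rule convex_on_imp_above_tangent[OF conv]) (auto intro: d1)
    have "(\<phi>' s - \<phi>' r) * (s - r) \<ge> 0"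
      using tangent[of r s] tangent[of s r] by (simp add: algebra_simps)
    with \<open>r \<le> s\<close> show "\<phi>' r \<le> \<phi>' s"
      by (cases "r = s") (auto simp: zero_le_mult_iff)
  qed
qed simp

section \<open>Power inequalities for real numbers\<close>

lemma square_powr_three_halves:
  fixes r :: real
  assumes "0 \<le> r"
  shows "(r\<^sup>2) powr (3 / 2) = r ^ 3"
proof (cases "r = 0")
  case False
  with assms have "0 < r" by simp
  then have "(r\<^sup>2) powr (3 / 2) = (r powr 2) powr (3 / 2)" by simp
  also have "\<dots> = r powr 3" unfolding powr_powr by simp
  finally show ?thesis using \<open>0 < r\<close> by simp
qed simp

text \<open>Young's inequality divided by h^\<alpha>. The right-hand side, as a function of
  \<open>a\<close>, is the tangent at \<open>h\<close> to the concave function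
  a^(1-\<alpha>).\<close>

lemma powr_weighted_mean_le:
  fixes a h \<alpha> :: real
  assumes "0 \<le> a" "0 < h" "0 \<le> \<alpha>" "\<alpha> < 1"
  shows "a powr (1 - \<alpha>) \<le> h powr (- \<alpha>) * ((1 - \<alpha>) * a + \<alpha> * h)"
proof (cases "a = 0")
  case False
  have "a powr (1 - \<alpha>) = h powr (- \<alpha>) * (a powr (1 - \<alpha>) * h powr \<alpha>)"
    using \<open>0 < h\<close> by (simp add: powr_minus)
  also have "\<dots> \<le> h powr (- \<alpha>) * ((1 - \<alpha>) * a + \<alpha> * h)"
    using False assms by (intro mult_left_mono Youngs_inequality_0) auto
  finally show ?thesis .
qed (use assms in simp)

text \<open>Jensen's inequality by averaging one common tangent at \<open>h\<close>. Its slope is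
  nonnegative, so an upper bound \<open>h\<close> on the mean suffices.\<close>

lemma mean_powr_le:
  fixes a :: "nat \<Rightarrow> real"
  assumes "N \<ge> 1" and a: "\<And>i. i \<in> {1..N} \<Longrightarrow> 0 \<le> a i" and h: "(1 / real N) * (\<Sum>i = 1..N. a i) \<le> h"
    and "0 < h" and \<alpha>: "0 \<le> \<alpha>" "\<alpha> < 1"
  shows "(1 / real N) * (\<Sum>i = 1..N. a i powr (1 - \<alpha>)) \<le> h powr (1 - \<alpha>)"
proof -
  have "(1 / real N) * (\<Sum>i = 1..N. a i powr (1 - \<alpha>))
      \<le> (1 / real N) * (\<Sum>i = 1..N. h powr (- \<alpha>) * ((1 - \<alpha>) * a i + \<alpha> * h))"
    using assms by (intro mult_left_mono sum_mono powr_weighted_mean_le) auto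
  also have "\<dots> = h powr (- \<alpha>) * ((1 - \<alpha>) * ((1 / real N) * (\<Sum>i = 1..N. a i)) + \<alpha> * h)"
    using \<open>N \<ge> 1\<close> by (simp add: sum.distrib flip: sum_distrib_left) (simp add: field_simps)
  also have "\<dots> \<le> h powr (- \<alpha>) * ((1 - \<alpha>) * h + \<alpha> * h)"
    using h \<alpha> by (intro mult_left_mono add_right_mono) auto
  also have "\<dots> = h powr (1 - \<alpha>)"
    using \<open>0 < h\<close> by (simp add: algebra_simps powr_diff powr_minus divide_inverse)
  finally show ?thesis .
qed

text \<open>Split |s|^3 as |s|^(1+2\<alpha>) times (s^2)^(1-\<alpha>). The second factor merges with
  p^(1-\<alpha>) into a power of the Hessian summand p s^2; only the first is estimated by
  \<open>r\<close>.\<close>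

lemma cubic_term_bound:
  fixes s r p d Q \<alpha> :: real
  assumes "0 \<le> p" "\<bar>d\<bar> \<le> Q * p powr (1 - \<alpha>)" "\<bar>s\<bar> \<le> r" "0 \<le> Q" "0 \<le> \<alpha>"
  shows "\<bar>d * s ^ 3\<bar> \<le> Q * r powr (1 + 2 * \<alpha>) * (p * s\<^sup>2) powr (1 - \<alpha>)"
proof (cases "s = 0")
  case True
  then show ?thesis using assms by simp
next
  case False
  have "\<bar>s\<bar> ^ 3 = \<bar>s\<bar> powr ((1 + 2 * \<alpha>) + 2 * (1 - \<alpha>))"
    by (simp add: algebra_simps)
  also have "\<dots> = \<bar>s\<bar> powr (1 + 2 * \<alpha>) * (\<bar>s\<bar> powr 2) powr (1 - \<alpha>)"
    by (simp only: powr_add powr_powr)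
  finally have s3: "\<bar>s\<bar> ^ 3 = \<bar>s\<bar> powr (1 + 2 * \<alpha>) * (s\<^sup>2) powr (1 - \<alpha>)"
    by simp
  have "\<bar>d * s ^ 3\<bar> = \<bar>d\<bar> * \<bar>s\<bar> ^ 3"
    by (simp add: abs_mult power_abs)
  also have "\<dots> \<le> (Q * p powr (1 - \<alpha>)) * (r powr (1 + 2 * \<alpha>) * (s\<^sup>2) powr (1 - \<alpha>))"
    unfolding s3 using assms by (intro mult_mono mult_right_mono powr_mono2) auto
  also have "\<dots> = Q * r powr (1 + 2 * \<alpha>) * (p * s\<^sup>2) powr (1 - \<alpha>)"
    using assms by (simp add: powr_mult mult_ac)
  finally show ?thesis .
qed

text \<open>The core estimate, free of matrices: \<open>p\<close>, \<open>d\<close>,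
  \<open>s\<close>, \<open>n\<close> stand for \<phi>'', y \<phi>''', the inner products of u with
  the data, and the norm of u.\<close>

lemma regularized_cubic_bound:
  fixes p d s :: "nat \<Rightarrow> real" and N :: nat and B Q \<alpha> \<gamma> n h :: real
  assumes N: "N \<ge> 1" and "0 < \<gamma>" "0 \<le> Q" "0 \<le> \<alpha>" "\<alpha> < 1" "0 \<le> B" "0 < n"
    and p: "\<And>i. i \<in> {1..N} \<Longrightarrow> 0 \<le> p i"
    and d: "\<And>i. i \<in> {1..N} \<Longrightarrow> \<bar>d i\<bar> \<le> Q * p i powr (1 - \<alpha>)"
    and s: "\<And>i. i \<in> {1..N} \<Longrightarrow> \<bar>s i\<bar> \<le> B * n"
    and h: "h = (1 / real N) * (\<Sum>i = 1..N. p i * (s i)\<^sup>2) + \<gamma> * n\<^sup>2"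
  shows "\<bar>(1 / real N) * (\<Sum>i = 1..N. d i * s i ^ 3)\<bar>
    \<le> B powr (1 + 2 * \<alpha>) * Q / \<gamma> powr (1 / 2 + \<alpha>) * h powr (3 / 2)"
proof -
  have mean0: "0 \<le> (1 / real N) * (\<Sum>i = 1..N. p i * (s i)\<^sup>2)"
    using p by (intro mult_nonneg_nonneg sum_nonneg) auto
  have "0 < \<gamma> * n\<^sup>2" using assms by simp
  \<comment> \<open>The regularizer makes \<open>h\<close> strictly positive, as
    \<open>mean_powr_le\<close> requires, even when every \<phi>'' vanishes.\<close>
  with mean0 have "0 < h" and n_le: "\<gamma> * n\<^sup>2 \<le> h"
    and mean_le: "(1 / real N) * (\<Sum>i = 1..N. p i * (s i)\<^sup>2) \<le> h"
    unfolding h by linarith+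
  have "\<bar>(1 / real N) * (\<Sum>i = 1..N. d i * s i ^ 3)\<bar> \<le> (1 / real N) * (\<Sum>i = 1..N. \<bar>d i * s i ^ 3\<bar>)"
    by (simp add: abs_mult[of "1 / real N"] divide_right_mono)
  also have "\<dots> \<le> (1 / real N)
      * (\<Sum>i = 1..N. Q * (B * n) powr (1 + 2 * \<alpha>) * (p i * (s i)\<^sup>2) powr (1 - \<alpha>))"
    using assms by (intro mult_left_mono sum_mono cubic_term_bound) auto
  also have "\<dots> = Q * (B * n) powr (1 + 2 * \<alpha>)
      * ((1 / real N) * (\<Sum>i = 1..N. (p i * (s i)\<^sup>2) powr (1 - \<alpha>)))"
    by (simp flip: sum_distrib_left)
  also have "\<dots> \<le> Q * (B * n) powr (1 + 2 * \<alpha>) * h powr (1 - \<alpha>)"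
    using assms \<open>0 < h\<close> mean_le by (intro mult_left_mono mean_powr_le) auto
  \<comment> \<open>Writing n^(1+2\<alpha>) as a power of n^2 prepares for n^2 \<le> h /
    \<gamma>.\<close>
  also have "\<dots> = Q * B powr (1 + 2 * \<alpha>) * (n\<^sup>2) powr (1 / 2 + \<alpha>) * h powr (1 - \<alpha>)"
  proof -
    have "(n\<^sup>2) powr (1 / 2 + \<alpha>) = (n powr 2) powr (1 / 2 + \<alpha>)"
      using \<open>0 < n\<close> by simp
    also have "\<dots> = n powr (1 + 2 * \<alpha>)"
      unfolding powr_powr by (simp add: algebra_simps)
    finally show ?thesis using assms by (simp add: powr_mult)
  qed
  also have "\<dots> \<le> Q * B powr (1 + 2 * \<alpha>) * (h / \<gamma>) powr (1 / 2 + \<alpha>) * h powr (1 - \<alpha>)"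
    using assms(2-6) n_le by (intro mult_left_mono mult_right_mono powr_mono2) (auto simp: field_simps)
  also have "\<dots> = B powr (1 + 2 * \<alpha>) * Q / \<gamma> powr (1 / 2 + \<alpha>) * (h powr (1 / 2 + \<alpha>) * h powr (1 - \<alpha>))"
    using \<open>0 < h\<close> \<open>0 < \<gamma>\<close> by (simp add: powr_divide)
  also have "h powr (1 / 2 + \<alpha>) * h powr (1 - \<alpha>) = h powr (3 / 2)"
    by (simp flip: powr_add)
  finally show ?thesis .
qed

section \<open>The regularized loss\<close>

lemma self_concordant_regularized_loss:
  fixes x :: "nat \<Rightarrow> real ^ 'n"
  assumes "N \<ge> 1" and x: "\<And>i. i \<in> {1..N} \<Longrightarrow> norm (x i) \<le> B"
    and y: "\<And>i. i \<in> {1..N} \<Longrightarrow> y i \<in> {-1, 1}"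
    and conv: "convex_on UNIV \<phi>"
    and d1: "\<And>t. (\<phi> has_real_derivative \<phi>' t) (at t)"
    and d2: "\<And>t. (\<phi>' has_real_derivative \<phi>'' t) (at t)"
    and d3: "\<And>t. (\<phi>'' has_real_derivative \<phi>''' t) (at t)"
    and cont: "continuous_on UNIV \<phi>'''"
    and pos: "\<gamma> > 0" "Q \<ge> 0" "0 \<le> \<alpha>" "\<alpha> < 1"
    and growth: "\<And>t. \<bar>\<phi>''' t\<bar> \<le> Q * \<phi>'' t powr (1 - \<alpha>)"
  shows "self_concordant (B powr (1 + 2 * \<alpha>) * Q / \<gamma> powr (1 / 2 + \<alpha>)) (regularized_loss \<phi> \<gamma> N x y)"
proof (rule self_concordantI)
  define m where "m = 1 / real N"
  define s where "s w i = y i * (w \<bullet> x i)" for w i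
  define g where "g w = m *\<^sub>R (\<Sum>i = 1..N. (y i * \<phi>' (s w i)) *\<^sub>R x i) + \<gamma> *\<^sub>R w" for w
  \<comment> \<open>Each differentiation contributes a factor y_i. Since y_i^2 = 1, none remains in
    \<open>H\<close> and a single one in \<open>T\<close>.\<close>
  define H where "H w = m *\<^sub>R (\<Sum>i = 1..N. \<phi>'' (s w i) *\<^sub>R outer_prod (x i) (x i)) + \<gamma> *\<^sub>R mat 1" for w
  define T where "T w u = m *\<^sub>R (\<Sum>i = 1..N. (y i * \<phi>''' (s w i) * (u \<bullet> x i)) *\<^sub>R outer_prod (x i) (x i))"
    for w u
  have "m \<ge> 0" by (simp add: m_def)
  have "B \<ge> 0"
    using order_trans[OF norm_ge_zero x[of 1]] \<open>N \<ge> 1\<close> by simp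
  \<comment> \<open>Used with F equal to \<phi>, \<phi>' and \<phi>'' in turn, once per order of
    differentiation.\<close>
  have comp: "((\<lambda>w. F (s w i)) has_derivative (\<lambda>u. F' (s w i) * (y i * (u \<bullet> x i)))) (at w)"
    if "\<And>t. (F has_real_derivative F' t) (at t)" for F F' i w
  proof -
    have "((\<lambda>w. s w i) has_derivative (\<lambda>u. y i * (u \<bullet> x i))) (at w)"
      unfolding s_def by (auto intro!: derivative_eq_intros)
    moreover have "(F has_derivative (*) (F' (s w i))) (at (s w i))"
      using that by (simp add: has_field_derivative_def)
    ultimately show ?thesis
      by (rule has_derivative_compose)
  qed
  show "convex_on UNIV (regularized_loss \<phi> \<gamma> N x y)"
    unfolding regularized_loss_def[abs_def]
    using pos by (intro convex_on_add convex_on_cmul convex_on_sum_fun convex_on_compose_inner conv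
        convex_on_norm_square) auto
  show "(regularized_loss \<phi> \<gamma> N x y has_derivative (\<lambda>u. g w \<bullet> u)) (at w)" for w
  proof -
    have "((\<lambda>w. m * (\<Sum>i = 1..N. \<phi> (s w i)) + \<gamma> / 2 * (w \<bullet> w)) has_derivative
        (\<lambda>u. m * (\<Sum>i = 1..N. \<phi>' (s w i) * (y i * (u \<bullet> x i))) + \<gamma> / 2 * (w \<bullet> u + u \<bullet> w))) (at w)"
      by (intro has_derivative_add has_derivative_mult_right has_derivative_sum comp[OF d1]
          has_derivative_inner has_derivative_ident)
    then show ?thesis
      unfolding regularized_loss_def[abs_def] m_def[symmetric] s_def[symmetric] power2_norm_eq_inner
      by (rule has_derivative_eq_rhs)
        (simp add: g_def s_def fun_eq_iff inner_add_right inner_sum_right inner_commute mult_ac)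
  qed
  show "(g has_derivative (\<lambda>u. H w *v u)) (at w)" for w
  proof -
    have "(g has_derivative (\<lambda>u. m *\<^sub>R (\<Sum>i = 1..N. (y i * (\<phi>'' (s w i) * (y i * (u \<bullet> x i)))) *\<^sub>R x i)
        + \<gamma> *\<^sub>R u)) (at w)"
      unfolding g_def
      by (intro has_derivative_add has_derivative_scaleR_right has_derivative_sum
          has_derivative_scaleR_left has_derivative_mult_right comp[OF d2] has_derivative_ident)
    also have "(\<lambda>u. m *\<^sub>R (\<Sum>i = 1..N. (y i * (\<phi>'' (s w i) * (y i * (u \<bullet> x i)))) *\<^sub>R x i) + \<gamma> *\<^sub>R u)
        = (\<lambda>u. H w *v u)"
    proof
      fix u
      have "(y i * (\<phi>'' (s w i) * (y i * (u \<bullet> x i)))) *\<^sub>R x i = (\<phi>'' (s w i) *\<^sub>R outer_prod (x i) (x i)) *v u"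
        if "i \<in> {1..N}" for i
        using y[OF that]
        by (auto simp: outer_prod_mult_vec inner_commute simp flip: scaleR_matrix_vector_assoc)
      then show "m *\<^sub>R (\<Sum>i = 1..N. (y i * (\<phi>'' (s w i) * (y i * (u \<bullet> x i)))) *\<^sub>R x i) + \<gamma> *\<^sub>R u = H w *v u"
        by (simp add: H_def matrix_vector_mult_add_rdistrib sum_matrix_vector_mult
            flip: scaleR_matrix_vector_assoc)
    qed
    finally show ?thesis .
  qed
  show "(H has_derivative T w) (at w)" for w
  proof -
    \<comment> \<open>The summand 0 is the derivative of the constant \<gamma> times the identity
      matrix.\<close>
    have "(H has_derivative (\<lambda>u. m *\<^sub>R (\<Sum>i = 1..N. (\<phi>''' (s w i) * (y i * (u \<bullet> x i))) *\<^sub>R outer_prod (x i) (x i))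
        + 0)) (at w)"
      unfolding H_def
      by (intro has_derivative_add has_derivative_scaleR_right has_derivative_sum
          has_derivative_scaleR_left comp[OF d3] has_derivative_const)
    then show ?thesis
      by (rule has_derivative_eq_rhs) (simp add: T_def fun_eq_iff mult_ac)
  qed
  have "continuous_on UNIV (\<lambda>w. \<phi>''' (s w i))" for i
    unfolding s_def by (rule continuous_on_compose2[OF cont]) (auto intro!: continuous_intros)
  then show "continuous_on UNIV (\<lambda>w. T w u)" for u
    unfolding T_def by (auto intro!: continuous_intros)
  fix w u
  show "\<bar>u \<bullet> (T w u *v u)\<bar>
      \<le> B powr (1 + 2 * \<alpha>) * Q / \<gamma> powr (1 / 2 + \<alpha>) * (u \<bullet> (H w *v u)) powr (3 / 2)"
  \<comment> \<open>For u = 0 both sides vanish; otherwise norm u > 0, as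
    \<open>regularized_cubic_bound\<close> requires.\<close>
  proof (cases "u = 0")
    case True
    then show ?thesis by simp
  next
    case False
    have form_H: "u \<bullet> (H w *v u) = m * (\<Sum>i = 1..N. \<phi>'' (s w i) * (u \<bullet> x i)\<^sup>2) + \<gamma> * (norm u)\<^sup>2"
      by (simp add: H_def matrix_vector_mult_add_rdistrib sum_matrix_vector_mult outer_prod_mult_vec
          inner_add_right inner_sum_right inner_commute dot_square_norm power2_eq_square mult_ac
          flip: scaleR_matrix_vector_assoc)
    have form_T: "u \<bullet> (T w u *v u) = m * (\<Sum>i = 1..N. (y i * \<phi>''' (s w i)) * (u \<bullet> x i) ^ 3)"
      by (simp add: T_def sum_matrix_vector_mult outer_prod_mult_vec inner_sum_right inner_commute
          power3_eq_cube mult_ac flip: scaleR_matrix_vector_assoc)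
    show ?thesis
      unfolding form_T unfolding m_def
    proof (rule regularized_cubic_bound)
      show "0 \<le> \<phi>'' (s w i)" for i
        by (rule convex_on_second_derivative_nonneg[OF conv d1 d2])
      show "\<bar>y i * \<phi>''' (s w i)\<bar> \<le> Q * \<phi>'' (s w i) powr (1 - \<alpha>)" if "i \<in> {1..N}" for i
        using y[OF that] growth[of "s w i"] by (auto simp: abs_mult)
      show "\<bar>u \<bullet> x i\<bar> \<le> B * norm u" if "i \<in> {1..N}" for i
        using Cauchy_Schwarz_ineq2[of u "x i"] mult_left_mono[OF x[OF that], of "norm u"]
        by (simp add: mult.commute)
      show "u \<bullet> (H w *v u) = (1 / real N) * (\<Sum>i = 1..N. \<phi>'' (s w i) * (u \<bullet> x i)\<^sup>2) + \<gamma> * (norm u)\<^sup>2"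
        using form_H by (simp add: m_def)
    qed (use assms False \<open>B \<ge> 0\<close> in auto)
  qed
qed

theorem lemma2:
  fixes N :: nat and X :: "(real ^ 'n) set" and B :: real
    and x :: "nat \<Rightarrow> real ^ 'n" and y :: "nat \<Rightarrow> real"
    and \<phi> :: "real \<Rightarrow> real" and \<gamma> Q \<alpha> :: real
  assumes "N \<ge> 1"
    and "\<And>i. i \<in> {1..N} \<Longrightarrow> x i \<in> X"
    and "bdd_above (norm ` X)" and "(SUP v\<in>X. norm v) \<le> B"
    and "\<And>i. i \<in> {1..N} \<Longrightarrow> y i \<in> {-1, 1}"
    and "convex_on UNIV \<phi>"
    and "\<And>k. k < 3 \<Longrightarrow> (deriv ^^ k) \<phi> differentiable_on UNIV"
    and "continuous_on UNIV ((deriv ^^ 3) \<phi>)"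
    and "\<gamma> > 0"
    and "Q > 0" and "0 \<le> \<alpha>" and "\<alpha> < 1"
    and "\<And>t. \<bar>(deriv ^^ 3) \<phi> t\<bar> \<le> Q * ((deriv ^^ 2) \<phi> t) powr (1 - \<alpha>)"
  shows "self_concordant (B powr (1 + 2 * \<alpha>) * Q / \<gamma> powr (1 / 2 + \<alpha>))
           (regularized_loss \<phi> \<gamma> N x y)
       \<and> standard_self_concordant
           (\<lambda>w. B powr (2 + 4 * \<alpha>) * Q\<^sup>2 / (4 * \<gamma> powr (1 + 2 * \<alpha>))
             * regularized_loss \<phi> \<gamma> N x y w)"
proof -
  let ?M = "B powr (1 + 2 * \<alpha>) * Q / \<gamma> powr (1 / 2 + \<alpha>)"
  let ?c = "B powr (2 + 4 * \<alpha>) * Q\<^sup>2 / (4 * \<gamma> powr (1 + 2 * \<alpha>))"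
  \<comment> \<open>Boundedness of \<open>X\<close> makes the supremum a genuine upper
    bound.\<close>
  have norm_x: "norm (x i) \<le> B" if "i \<in> {1..N}" for i
    using cSUP_upper[OF assms(2)[OF that] assms(3)] assms(4) by linarith
  have deriv: "((deriv ^^ k) \<phi> has_real_derivative (deriv ^^ Suc k) \<phi> t) (at t)" if "k < 3" for k t
    using assms(7)[OF that]
    by (auto simp: differentiable_on_def real_differentiable_def DERIV_deriv_iff_real_differentiable)
  have a: "self_concordant ?M (regularized_loss \<phi> \<gamma> N x y)"
  proof (rule self_concordant_regularized_loss[where \<phi>' = "(deriv ^^ 1) \<phi>" and \<phi>'' = "(deriv ^^ 2) \<phi>"
        and \<phi>''' = "(deriv ^^ 3) \<phi>"])
    show "(\<phi> has_real_derivative (deriv ^^ 1) \<phi> t) (at t)" for t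
      using deriv[of 0] by simp
    show "((deriv ^^ 1) \<phi> has_real_derivative (deriv ^^ 2) \<phi> t) (at t)" for t
      using deriv[of 1] by (simp add: numeral_2_eq_2)
    show "((deriv ^^ 2) \<phi> has_real_derivative (deriv ^^ 3) \<phi> t) (at t)" for t
      using deriv[of 2] by (simp add: numeral_3_eq_3 numeral_2_eq_2)
  qed (use assms norm_x in auto)
  have "0 \<le> ?M" using \<open>Q > 0\<close> by simp
  \<comment> \<open>Parameter 2 requires c M \<le> 2 c^(3/2). The choice sqrt c = M / 2 gives
    equality, also when \<open>B\<close> = 0 makes both c and M zero.\<close>
  have "?c = (?M / 2)\<^sup>2"
  proof -
    have "(B powr (1 + 2 * \<alpha>))\<^sup>2 = B powr (2 + 4 * \<alpha>)"
      and "(\<gamma> powr (1 / 2 + \<alpha>))\<^sup>2 = \<gamma> powr (1 + 2 * \<alpha>)"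
      by (simp_all add: power2_eq_square flip: powr_add)
    then show ?thesis by (simp add: power_divide power_mult_distrib)
  qed
  moreover have "((?M / 2)\<^sup>2) powr (3 / 2) = (?M / 2) ^ 3"
    by (rule square_powr_three_halves) (simp only: divide_nonneg_pos \<open>0 \<le> ?M\<close> zero_less_numeral)
  moreover have "(r / 2)\<^sup>2 * r = 2 * (r / 2) ^ 3" for r :: real
    by (simp add: power2_eq_square power3_eq_cube)
  ultimately have "?c * ?M \<le> 2 * ?c powr (3 / 2)"
    by (simp only: order_refl)
  then have "self_concordant 2 (\<lambda>w. ?c * regularized_loss \<phi> \<gamma> N x y w)"
    by (intro self_concordant_scale[OF a]) auto
  with a show ?thesis
    by (simp add: standard_self_concordant_def)
qed

end
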